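(* Let $m\geq 2$ and let $\prec$ be a linear order on the set $\{1,\ldots,m-1\}$. Suppose that there exists $t\in\{1,\ldots,m-1\}$ such that $$t\prec t+1\prec t+2\prec\cdots\prec m-1 \quad\text{and}\quad t\prec t-1\prec t-2\prec\cdots\prec 1.$$ Then $\mathfrak{fr}(\mathcal{F}[\prec])\leq 1$.
   Context: For a set $Z$, $[Z]^{<\omega}$ denotes the family of all finite subsets of $Z$. The cardinal $\aleph_n$ is identified with the set of all ordinals below the initial ordinal $\omega_n$. For a finite family $\mathcal{F}$ of finite sets, $\mathfrak{fr}(\mathcal{F})$ is the least natural number $n\geq 0$ such that for every function $S:[\aleph_n]^{<\omega}\to[\aleph_n]^{<\omega}$ there exist $Y\subset\aleph_n$ and a bijection $u:\bigcup\mathcal{F}\to Y$ such that $S(u(A))\cap Y\subset u(A)$ for all $A\in\mathcal{F}$, where $u(A)=\{u(a):a\in A\}$ (such an $n$ always exists). For a linear order $\prec$ on $\{1,\ldots,m-1\}$, $\mathcal{F}[\prec]$ is the family of all sets $A\subset\{1,\ldots,m\}$ such that, for all $t_1,t_2,t_3\in\{1,\ldots,m\}$ with $t_1>t_2$, $t_1>t_3$ (in the usual order) and $t_2\succ t_3$, if $t_1,t_2\in A$ then $t_3\in A$. *)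

theory Defs
  imports "HOL-Library.Countable_Set_Type" "HOL-Library.FuncSet"
begin

unbundle cardinal_syntax

text \<open>
  No single HOL type can be shown to contain sets of all the cardinalities aleph-n. Instead,
  \<open>has_card_aleph n Z\<close> says that \<open>Z\<close>, a set over an arbitrary host type, has cardinality aleph-n.
  Only the cardinality of the ground set matters below.
\<close>

fun has_card_aleph :: "nat \<Rightarrow> 'u set \<Rightarrow> bool" where
  "has_card_aleph 0 Z \<longleftrightarrow> |Z| =o natLeq"
| "has_card_aleph (Suc n) Z \<longleftrightarrow> (\<exists>W :: 'u set. has_card_aleph n W \<and> |Z| =o cardSuc |W| )"

text \<open>Here \<open>Z\<close> plays the role of aleph-n; \<open>Fpow Z\<close> is the set of all finite subsets of \<open>Z\<close>.\<close>

definition free_realizable :: "'u set \<Rightarrow> 'a set set \<Rightarrow> bool" where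
  "free_realizable Z F \<longleftrightarrow>
     (\<forall>S \<in> Fpow Z \<rightarrow> Fpow Z. \<exists>Y u. Y \<subseteq> Z \<and> bij_betw u (\<Union>F) Y \<and>
        (\<forall>A\<in>F. S (u ` A) \<inter> Y \<subseteq> u ` A))"

text \<open>
  The type argument is the host type in which the sets of cardinality aleph-n are taken.
  An \<open>n\<close> for which the host type has no such set is not admitted, so \<open>fr\<close> is the
  intended number whenever the host type is large enough, and unspecified otherwise. By \<open>free_realizable_cong\<close> and \<open>has_card_aleph_unique\<close> below,
  which set of cardinality aleph-n is used, and in which type, is irrelevant.
\<close>

definition fr :: "'u itself \<Rightarrow> 'a set set \<Rightarrow> nat" where
  "fr (_ :: 'u itself) F =
     (LEAST n. \<exists>Z :: 'u set. has_card_aleph n Z \<and> free_realizable Z F)"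

text \<open>The pair \<open>(a, b) \<in> r\<close> means that \<open>a\<close> precedes \<open>b\<close> strictly.\<close>

definition order_family :: "nat \<Rightarrow> nat rel \<Rightarrow> nat set set" where
  "order_family m r =
     {A. A \<subseteq> {1..m} \<and>
         (\<forall>t1\<in>{1..m}. \<forall>t2\<in>{1..m}. \<forall>t3\<in>{1..m}.
            t1 > t2 \<and> t1 > t3 \<and> (t3, t2) \<in> r \<longrightarrow> t1 \<in> A \<and> t2 \<in> A \<longrightarrow> t3 \<in> A)}"

lemma has_card_aleph_unique:
  fixes Z :: "'u set" and Z' :: "'v set"
  assumes "has_card_aleph n Z" "has_card_aleph n Z'"
  shows "|Z| =o |Z'|"
  using assms
proof (induction n arbitrary: Z Z')
  case 0
  then have Z: "|Z| =o natLeq" and Z': "|Z'| =o natLeq" by simp_all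
  show ?case by (rule ordIso_transitive[OF Z ordIso_symmetric[OF Z']])
next
  case (Suc n)
  obtain W :: "'u set" where W: "has_card_aleph n W" "|Z| =o cardSuc |W|"
    using Suc.prems(1) unfolding has_card_aleph.simps by blast
  obtain W' :: "'v set" where W': "has_card_aleph n W'" "|Z'| =o cardSuc |W'|"
    using Suc.prems(2) unfolding has_card_aleph.simps by blast
  have "|W| =o |W'|" using Suc.IH W W' by blast
  then have *: "cardSuc |W| =o cardSuc |W'|"
    using cardSuc_invar_ordIso[OF card_of_Card_order card_of_Card_order] by blast
  show ?case
    by (rule ordIso_transitive[OF W(2) ordIso_transitive[OF * ordIso_symmetric[OF W'(2)]]])
qed

lemma free_realizable_cong:
  fixes Z :: "'u set" and Z' :: "'v set"
  assumes "|Z| =o |Z'|" and "free_realizable Z F"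
  shows "free_realizable Z' F"
  unfolding free_realizable_def
proof
  fix S' assume S': "S' \<in> Fpow Z' \<rightarrow> Fpow Z'"
  obtain g where g: "bij_betw g Z Z'" using assms(1) unfolding card_of_ordIso[symmetric] ..
  define h where "h = the_inv_into Z g"
  have h: "bij_betw h Z' Z" "\<And>x. x \<in> Z' \<Longrightarrow> g (h x) = x" "\<And>x. x \<in> Z \<Longrightarrow> h (g x) = x"
    using g unfolding h_def
    by (simp_all add: bij_betw_the_inv_into f_the_inv_into_f_bij_betw the_inv_into_f_f bij_betw_imp_inj_on)
  define S where "S = (\<lambda>A. h ` S' (g ` A))"
  have "S \<in> Fpow Z \<rightarrow> Fpow Z"
  proof
    fix A assume "A \<in> Fpow Z"
    then have "g ` A \<in> Fpow Z'"
      using bij_betw_imp_surj_on[OF g] unfolding Fpow_def by blast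
    then have "S' (g ` A) \<in> Fpow Z'" by (rule funcset_mem[OF S'])
    then show "S A \<in> Fpow Z"
      using bij_betw_imp_surj_on[OF h(1)] unfolding S_def Fpow_def by blast
  qed
  with assms(2) have "\<exists>Y u. Y \<subseteq> Z \<and> bij_betw u (\<Union>F) Y \<and> (\<forall>A\<in>F. S (u ` A) \<inter> Y \<subseteq> u ` A)"
    unfolding free_realizable_def by (rule bspec)
  then obtain Y u where Y: "Y \<subseteq> Z" "bij_betw u (\<Union>F) Y"
      "\<forall>A\<in>F. S (u ` A) \<inter> Y \<subseteq> u ` A"
    by (elim exE conjE)
  have "bij_betw g Y (g ` Y)" by (rule bij_betw_subset[OF g Y(1) refl])
  then have bij: "bij_betw (g \<circ> u) (\<Union>F) (g ` Y)" by (rule bij_betw_trans[OF Y(2)])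
  have "S' ((g \<circ> u) ` A) \<inter> g ` Y \<subseteq> (g \<circ> u) ` A" if "A \<in> F" for A
  proof
    fix x assume x: "x \<in> S' ((g \<circ> u) ` A) \<inter> g ` Y"
    then obtain y where y: "y \<in> Y" "x = g y" by blast
    have "h x = y" using y Y(1) h(3) by blast
    moreover have "h x \<in> S (u ` A)" using x by (simp add: S_def image_comp)
    ultimately have "y \<in> S (u ` A)" by simp
    then have "y \<in> u ` A" using Y(3) that y(1) by blast
    then show "x \<in> (g \<circ> u) ` A" unfolding y(2) image_comp[symmetric] by (rule imageI)
  qed
  moreover have "g ` Y \<subseteq> Z'" using bij_betw_imp_surj_on[OF g] Y(1) by blast
  ultimately show "\<exists>Y u. Y \<subseteq> Z' \<and> bij_betw u (\<Union>F) Y \<and> (\<forall>A\<in>F. S' (u ` A) \<inter> Y \<subseteq> u ` A)"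
    using bij by (intro exI[of _ "g ` Y"] exI[of _ "g \<circ> u"] conjI ballI)
qed

lemma uncountable_has_card_aleph_1:
  assumes "uncountable (UNIV :: 'u set)"
  shows "\<exists>Z :: 'u set. has_card_aleph 1 Z"
proof -
  have "infinite (UNIV :: 'u set)" using assms countable_finite by blast
  then obtain W :: "'u set" where W: "countable W" "infinite W"
    using infinite_countable_subset' by blast
  have "bij_betw (to_nat_on W) W UNIV" using W by (rule to_nat_on_infinite)
  then have "|W| =o |UNIV :: nat set|" unfolding card_of_ordIso[symmetric] by blast
  then have Wn: "|W| =o natLeq" using card_of_nat by (rule ordIso_transitive)
  have "\<not> |UNIV :: 'u set| \<le>o |W|"
  proof
    assume "|UNIV :: 'u set| \<le>o |W|"
    then have "|UNIV :: 'u set| \<le>o natLeq" using Wn by (rule ordLeq_ordIso_trans)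
    then show False using assms by (simp add: countable_card_le_natLeq)
  qed
  then have "|W| <o |UNIV :: 'u set|"
    using not_ordLeq_iff_ordLess[OF card_of_Well_order card_of_Well_order] by blast
  then have le: "cardSuc |W| \<le>o |UNIV :: 'u set|"
    using cardSuc_ordLess_ordLeq[OF card_of_Card_order card_of_Card_order] by blast
  have F: "|Field (cardSuc |W| )| =o cardSuc |W|"
    by (rule card_of_Field_ordIso) (rule cardSuc_Card_order[OF card_of_Card_order])
  then have "|Field (cardSuc |W| )| \<le>o |UNIV :: 'u set|" using le by (rule ordIso_ordLeq_trans)
  then obtain f :: "'u set \<Rightarrow> 'u" where f: "inj_on f (Field (cardSuc |W| ))"
    unfolding card_of_ordLeq[symmetric] by blast
  then have "bij_betw f (Field (cardSuc |W| )) (f ` Field (cardSuc |W| ))"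
    by (rule inj_on_imp_bij_betw)
  then have "|Field (cardSuc |W| )| =o |f ` Field (cardSuc |W| )|"
    unfolding card_of_ordIso[symmetric] by blast
  then have "|f ` Field (cardSuc |W| )| =o cardSuc |W|"
    by (rule ordIso_transitive[OF ordIso_symmetric F])
  then show ?thesis using Wn unfolding One_nat_def has_card_aleph.simps by blast
qed

end

theory Submission
  imports Defs
begin

text \<open>
  Add \<open>m\<close> as last element to the order \<open>r\<close> and call the result \<open>R\<close>. Below the maximum \<open>M\<close> of a
  member \<open>A\<close> of the family, \<open>A\<close> is an initial segment of \<open>R\<close>; so if \<open>j < M\<close> is missing from
  \<open>A\<close>, then all elements of \<open>A\<close> other than \<open>M\<close> precede \<open>j\<close> in \<open>R\<close>. As \<open>R\<close> first decreases
  and then increases, with its minimum at \<open>t\<close>, its initial segments are intervals around \<open>t\<close>.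
  Given a set mapping \<open>S\<close> on an uncountable set \<open>Z\<close>, the points \<open>x j\<close> are therefore chosen in
  the order \<open>R\<close>, so that at each moment the indices used form an interval, which then grows by one
  at its left or right end. The aim is \<open>x j \<notin> S (x ` A)\<close> whenever \<open>A\<close> is in the family and
  \<open>j \<notin> A\<close>.

  Two features of an uncountable set are used. First, there is an increasing sequence of countable
  \<open>S\<close>-closed sets \<open>D i\<close> with infinite differences. Taking the point of index \<open>Suc i \<le> t\<close> from
  \<open>D (Suc i) - D i\<close>, and each point of index above \<open>t\<close> outside the countable set of all values of
  \<open>S\<close> at finite subsets of what lies below it, guarantees that no point is captured by smaller
  indices; this settles \<open>j > M\<close>. Second, a set mapping with finite values has an uncountable free
  set. During the construction an uncountable reservoir \<open>H\<close> for the points to the right and infinite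
  reservoirs for the points to the left are kept. Before each choice they are thinned out, by the
  free set result and by making the trace of the finite values on the countable part constant, so
  that no element of \<open>H\<close>, together with points already chosen, captures another element of a
  reservoir (\<open>refine\<close>). This settles \<open>j < M\<close> when \<open>x j\<close> is chosen before \<open>x M\<close>; when it is
  chosen after it, only finitely or countably many values have to be avoided. The steps
  \<open>step_down\<close> and \<open>step_up\<close> carry this out, and \<open>stage_exists\<close> iterates them along \<open>R\<close>.
\<close>

section \<open>Uncountable free sets\<close>

lemma uncountable_constant_fibre:
  assumes "uncountable H" "countable (f ` H)"
  obtains y where "uncountable {x \<in> H. f x = y}"
proof (rule ccontr)
  assume "\<not> thesis"
  then have "countable (\<Union>y \<in> f ` H. {x \<in> H. f x = y})"
    using that assms(2) by (intro countable_UN) auto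
  moreover have "(\<Union>y \<in> f ` H. {x \<in> H. f x = y}) = H" by auto
  ultimately show False using assms(1) by simp
qed

text \<open>A countable set has only countably many finite subsets, so some trace occurs uncountably often.\<close>

lemma uncountable_constant_trace:
  assumes "uncountable H" "countable C" "\<And>x. x \<in> H \<Longrightarrow> finite (f x)"
  obtains T where "T \<subseteq> C" "finite T" "uncountable {x \<in> H. f x \<inter> C = T}"
proof -
  have "(\<lambda>x. f x \<inter> C) ` H \<subseteq> {T. T \<subseteq> C \<and> finite T}" using assms(3) by auto
  then have "countable ((\<lambda>x. f x \<inter> C) ` H)"
    using countable_Collect_finite_subset[OF assms(2)] countable_subset
    by (metis (no_types, lifting) Collect_cong)
  then obtain T where T: "uncountable {x \<in> H. f x \<inter> C = T}"
    using uncountable_constant_fibre[OF assms(1)] by blast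
  then have "{x \<in> H. f x \<inter> C = T} \<noteq> {}" by force
  then show ?thesis using that[OF _ _ T] assms(3) by blast
qed

definition free_for :: "('u \<Rightarrow> 'u set) \<Rightarrow> 'u set \<Rightarrow> bool" where
  "free_for f G \<longleftrightarrow> (\<forall>x\<in>G. \<forall>y\<in>G. x \<noteq> y \<longrightarrow> y \<notin> f x)"

lemma maximal_free_subset:
  obtains G where "G \<subseteq> H" "free_for f G"
    "\<And>x. x \<in> H - G \<Longrightarrow> \<not> free_for f (insert x G)"
proof -
  let ?A = "{G. G \<subseteq> H \<and> free_for f G}"
  have "\<exists>M\<in>?A. \<forall>X\<in>?A. M \<subseteq> X \<longrightarrow> X = M"
  proof (rule subset_Zorn')
    fix C assume C: "subset.chain ?A C"
    have "free_for f (\<Union>C)"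
      unfolding free_for_def
    proof (intro ballI impI)
      fix x y assume xy: "x \<in> \<Union>C" "y \<in> \<Union>C" "x \<noteq> y"
      then obtain X Y where "X \<in> C" "x \<in> X" "Y \<in> C" "y \<in> Y" by blast
      moreover have "X \<subseteq> Y \<or> Y \<subseteq> X"
        using C \<open>X \<in> C\<close> \<open>Y \<in> C\<close> unfolding subset.chain_def by blast
      ultimately obtain W where "W \<in> C" "x \<in> W" "y \<in> W" by blast
      then show "y \<notin> f x" using C xy(3) unfolding subset.chain_def free_for_def by blast
    qed
    then show "\<Union>C \<in> ?A" using C unfolding subset.chain_def by blast
  qed
  then obtain G where "G \<in> ?A" and max: "\<forall>X\<in>?A. G \<subseteq> X \<longrightarrow> X = G" by blast
  moreover have "\<not> free_for f (insert x G)" if "x \<in> H - G" for x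
    using max that \<open>G \<in> ?A\<close> by blast
  ultimately show ?thesis using that[of G] by blast
qed

text \<open>
  Induction on the bound \<open>n\<close>. If a maximal free set \<open>G\<close> happens to be countable, then all but
  countably many \<open>x\<close> have a value \<open>f x\<close> that meets \<open>G\<close>; deleting \<open>G\<close> from the values and from
  the domain lowers the bound and does not affect freeness.
\<close>

lemma uncountable_free_subset_bounded:
  assumes "uncountable H" "\<And>x. x \<in> H \<Longrightarrow> finite (f x) \<and> card (f x) \<le> n"
  shows "\<exists>G\<subseteq>H. uncountable G \<and> free_for f G"
  using assms
proof (induction n arbitrary: H f)
  case 0
  then have "f x = {}" if "x \<in> H" for x
    using that 0(2)[of x] by (metis card_0_eq le_zero_eq)
  then have "free_for f H" unfolding free_for_def by blast
  then show ?case using 0 by blast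
next
  case (Suc n)
  obtain G where G: "G \<subseteq> H" "free_for f G"
    and max: "\<And>x. x \<in> H - G \<Longrightarrow> \<not> free_for f (insert x G)"
    using maximal_free_subset by blast
  show ?case
  proof (cases "countable G")
    case False
    then show ?thesis using G by blast
  next
    case True
    define H' where "H' = H - G - (\<Union>y\<in>G. f y)"
    have "countable (G \<union> (\<Union>y\<in>G. f y))"
    proof (intro countable_Un countable_UN)
      show "countable (f y)" if "y \<in> G" for y
        using that G(1) Suc.prems(2) countable_finite by blast
    qed (use True in simp_all)
    then have "uncountable (H - (G \<union> (\<Union>y\<in>G. f y)))"
      using uncountable_minus_countable[OF Suc.prems(1)] by blast
    moreover have "H - (G \<union> (\<Union>y\<in>G. f y)) = H'" unfolding H'_def by blast
    ultimately have "uncountable H'" by simp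
    moreover have "finite (f x - G) \<and> card (f x - G) \<le> n" if x: "x \<in> H'" for x
    proof -
      have "f x \<inter> G \<noteq> {}"
        using max[of x] x G(2) unfolding H'_def free_for_def by blast
      then have "f x - G \<subset> f x" by blast
      then have "card (f x - G) < card (f x)"
        using x Suc.prems(2)[of x] psubset_card_mono unfolding H'_def by blast
      then show ?thesis using x Suc.prems(2)[of x] unfolding H'_def by auto
    qed
    ultimately obtain G' where G': "G' \<subseteq> H'" "uncountable G'" "free_for (\<lambda>x. f x - G) G'"
      using Suc.IH[of H' "\<lambda>x. f x - G"] by blast
    then have "free_for f G'" unfolding free_for_def H'_def by blast
    then show ?thesis using G' unfolding H'_def by blast
  qed
qed

lemma uncountable_free_subset:
  assumes "uncountable H" "\<And>x. x \<in> H \<Longrightarrow> finite (f x)"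
  obtains G where "G \<subseteq> H" "uncountable G" "free_for f G"
proof -
  obtain n where "uncountable {x \<in> H. card (f x) = n}"
  proof (rule uncountable_constant_fibre[OF assms(1)])
    show "countable ((\<lambda>x. card (f x)) ` H)" by simp
  qed
  moreover have "finite (f x) \<and> card (f x) \<le> n" if "x \<in> {x \<in> H. card (f x) = n}" for x
    using that assms(2) by simp
  ultimately obtain G where "G \<subseteq> {x \<in> H. card (f x) = n}" "uncountable G" "free_for f G"
    using uncountable_free_subset_bounded[of "{x \<in> H. card (f x) = n}" f n] by blast
  then show ?thesis using that[of G] by blast
qed

section \<open>Countable sets closed under a set mapping\<close>

lemma countable_closed_superset:
  fixes S :: "'u set \<Rightarrow> 'u set"
  assumes S: "S \<in> Fpow Z \<rightarrow> Fpow Z" and "countable C" "C \<subseteq> Z"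
  shows "\<exists>D. C \<subseteq> D \<and> countable D \<and> D \<subseteq> Z \<and> (\<forall>Q\<in>Fpow D. S Q \<subseteq> D)"
proof -
  define N where "N = rec_nat C (\<lambda>_ X. X \<union> (\<Union>Q\<in>Fpow X. S Q))"
  have N0: "N 0 = C" and NS: "\<And>n. N (Suc n) = N n \<union> (\<Union>Q\<in>Fpow (N n). S Q)"
    unfolding N_def by simp_all
  have N: "countable (N n) \<and> N n \<subseteq> Z" for n
  proof (induction n)
    case 0
    then show ?case using assms N0 by simp
  next
    case (Suc n)
    then have Q: "S Q \<in> Fpow Z" if "Q \<in> Fpow (N n)" for Q
      using that by (intro funcset_mem[OF S]) (auto simp: Fpow_def)
    have "countable (Fpow (N n))"
      using Suc countable_Fpow by blast
    then have "countable (\<Union>Q\<in>Fpow (N n). S Q)"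
    proof (rule countable_UN)
      show "countable (S Q)" if "Q \<in> Fpow (N n)" for Q
        using Q[OF that] countable_finite unfolding Fpow_def by blast
    qed
    then show ?case using Suc Q unfolding NS by (auto simp: Fpow_def)
  qed
  have mono: "N i \<subseteq> N j" if "i \<le> j" for i j
    using that by (rule lift_Suc_mono_le[of N, rotated]) (simp add: NS)
  show ?thesis
  proof (intro exI[of _ "\<Union>n. N n"] conjI ballI)
    show "C \<subseteq> (\<Union>n. N n)" using N0 by blast
    show "countable (\<Union>n. N n)" "(\<Union>n. N n) \<subseteq> Z" using N by auto
    fix Q assume Q: "Q \<in> Fpow (\<Union>n. N n)"
    have "\<exists>n. Q \<subseteq> N n"
    proof -
      have "finite Q" "Q \<subseteq> (\<Union>n. N n)" using Q by (auto simp: Fpow_def)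
      then show ?thesis
      proof (induction Q rule: finite_induct)
        case (insert q Q)
        then obtain i j where "q \<in> N i" "Q \<subseteq> N j" by blast
        then have "insert q Q \<subseteq> N (max i j)" using mono[of i "max i j"] mono[of j "max i j"] by auto
        then show ?case ..
      qed simp
    qed
    then obtain n where "Q \<in> Fpow (N n)" using Q by (auto simp: Fpow_def)
    then show "S Q \<subseteq> (\<Union>n. N n)" using NS[of n] by blast
  qed
qed

text \<open>
  The sets \<open>D i\<close> play the part of closed countable ordinals: points chosen in successive
  differences come in an order in which no point is captured by smaller ones.
\<close>

locale closed_tower =
  fixes Z :: "'u set" and S :: "'u set \<Rightarrow> 'u set" and D :: "nat \<Rightarrow> 'u set"
  assumes S: "S \<in> Fpow Z \<rightarrow> Fpow Z"
    and D_subset: "D i \<subseteq> Z"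
    and D_countable: "countable (D i)"
    and D_closed: "Q \<in> Fpow (D i) \<Longrightarrow> S Q \<subseteq> D i"
    and D_Suc: "D i \<subseteq> D (Suc i)"
    and D_gap: "infinite (D (Suc i) - D i)"
begin

lemma S_finite: "finite Q \<Longrightarrow> Q \<subseteq> Z \<Longrightarrow> finite (S Q)"
  using funcset_mem[OF S, of Q] unfolding Fpow_def by blast

end

lemma closed_tower_exists:
  fixes Z :: "'u set"
  assumes S: "S \<in> Fpow Z \<rightarrow> Fpow Z" and Z: "uncountable Z"
  obtains D where "closed_tower Z S D"
proof -
  define P where "P = (\<lambda>D. countable D \<and> D \<subseteq> Z \<and> (\<forall>Q\<in>Fpow D. S Q \<subseteq> D))"
  have "\<exists>D. P D"
    using countable_closed_superset[OF S countable_empty empty_subsetI] unfolding P_def by blast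
  moreover have "\<exists>D'. P D' \<and> D \<subseteq> D' \<and> infinite (D' - D)" if "P D" for D
  proof -
    have D: "countable D" "D \<subseteq> Z" using \<open>P D\<close> unfolding P_def by simp_all
    have "uncountable (Z - D)" using Z D(1) by (rule uncountable_minus_countable)
    then have "infinite (Z - D)" by (rule uncountable_infinite)
    then obtain C where C: "C \<subseteq> Z - D" "countable C" "infinite C"
      using infinite_countable_subset' by blast
    have "countable (D \<union> C)" "D \<union> C \<subseteq> Z" using C D by auto
    then have "\<exists>D'. D \<union> C \<subseteq> D' \<and> P D'"
      unfolding P_def by (rule countable_closed_superset[OF S])
    then obtain D' where D': "D \<union> C \<subseteq> D'" "P D'" by blast
    have "C \<subseteq> D' - D" using C D' by blast
    then have "infinite (D' - D)" using C(3) finite_subset by blast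
    moreover have "D \<subseteq> D'" using D'(1) by blast
    ultimately show ?thesis using D'(2) by blast
  qed
  ultimately have "\<exists>D. \<forall>i. P (D i) \<and> D i \<subseteq> D (Suc i) \<and> infinite (D (Suc i) - D i)"
    by (intro dependent_nat_choice)
  then obtain D where D: "\<And>i. P (D i)" "\<And>i. D i \<subseteq> D (Suc i)" "\<And>i. infinite (D (Suc i) - D i)"
    by blast
  have "closed_tower Z S D"
  proof
    show "S \<in> Fpow Z \<rightarrow> Fpow Z" by (rule S)
  qed (use D in \<open>auto simp: P_def\<close>)
  then show ?thesis by (rule that)
qed

section \<open>Choosing the points\<close>

locale tower_order = closed_tower Z S D
  for Z :: "'u set" and S D +
  fixes m :: nat and R :: "nat rel"
  assumes R_strict: "strict_linear_order_on {1..m} R"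
begin

lemma R_asym: "(i, j) \<in> R \<Longrightarrow> (j, i) \<notin> R"
  using R_strict unfolding strict_linear_order_on_def irrefl_def trans_def by blast

lemma R_total: "i \<in> {1..m} \<Longrightarrow> j \<in> {1..m} \<Longrightarrow> i \<noteq> j \<Longrightarrow> (i, j) \<in> R \<or> (j, i) \<in> R"
  using R_strict unfolding strict_linear_order_on_def total_on_def by blast

lemma R_trans: "(i, j) \<in> R \<Longrightarrow> (j, k) \<in> R \<Longrightarrow> (i, k) \<in> R"
  using R_strict unfolding strict_linear_order_on_def trans_def by blast

end

text \<open>
  A stage of the construction: the points with indices in \<open>{c<..b}\<close> have been chosen. The points
  of larger index will come from \<open>H\<close>, the point of index \<open>Suc i \<le> c\<close> from \<open>L \<inter> (D (Suc i) - D i)\<close>.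
  \<open>chosen_free\<close> is the goal, restricted to the chosen indices. The other two conditions keep it
  attainable: \<open>chosen_free_top\<close> anticipates a maximum of \<open>A\<close> that is chosen later, with \<open>P\<close> the
  rest of \<open>A\<close>, and \<open>chosen_high\<close> protects a point from everything of smaller index, including all
  points of index at most \<open>c\<close>, which are going to lie in \<open>D c\<close>.
\<close>

locale stage = tower_order Z S D m R
  for Z :: "'u set" and S D m R +
  fixes c b :: nat and x :: "nat \<Rightarrow> 'u" and H L :: "'u set"
  assumes b_le: "b \<le> m"
    and x_in: "j \<in> {c<..b} \<Longrightarrow> x j \<in> Z"
    and H_in: "H \<subseteq> Z"
    and H_uncountable: "uncountable H"
    and L_countable: "countable L"
    and L_infinite: "i < c \<Longrightarrow> infinite (L \<inter> (D (Suc i) - D i))"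
    and chosen_free: "A \<in> order_family m R \<Longrightarrow> A \<subseteq> {c<..b} \<Longrightarrow> j \<in> {c<..b} \<Longrightarrow> j \<notin> A \<Longrightarrow>
      x j \<notin> S (x ` A)"
    and chosen_free_top: "M \<in> H \<Longrightarrow> j \<in> {c<..b} \<Longrightarrow> P \<subseteq> {c<..b} \<Longrightarrow> \<forall>p\<in>P. (p, j) \<in> R \<Longrightarrow>
      x j \<notin> S (insert M (x ` P))"
    and chosen_high: "j \<in> {c<..b} \<Longrightarrow> finite Q \<Longrightarrow> Q \<subseteq> x ` {c<..<j} \<union> D c \<Longrightarrow> x j \<notin> S Q"

text \<open>
  In a refined stage any element of \<open>H\<close>, or any element of \<open>L\<close> in the right difference, may be
  taken as the next point.
\<close>

locale refined_stage = stage Z S D m R c b x H L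
  for Z :: "'u set" and S D m R c b x H L +
  assumes H_free: "M \<in> H \<Longrightarrow> N \<in> H \<Longrightarrow> M \<noteq> N \<Longrightarrow> P \<subseteq> {c<..b} \<Longrightarrow> N \<notin> S (insert M (x ` P))"
    and L_free_top: "M \<in> H \<Longrightarrow> l \<in> L \<Longrightarrow> P \<subseteq> {c<..b} \<Longrightarrow> l \<notin> S (insert M (x ` P))"
    and L_free: "l \<in> L \<Longrightarrow> P \<subseteq> {c<..b} \<Longrightarrow> l \<notin> S (x ` P)"
    and H_high: "M \<in> H \<Longrightarrow> finite Q \<Longrightarrow> Q \<subseteq> x ` {c<..b} \<union> D c \<Longrightarrow> M \<notin> S Q"

text \<open>
  Only finitely many sets \<open>P\<close> matter, so \<open>M\<close> captures with their help just the finite set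
  \<open>f M\<close>. Passing from \<open>H\<close> to a set free for \<open>f\<close> on which the trace \<open>f M \<inter> L\<close> is a constant \<open>T\<close>
  keeps it uncountable; then deleting the finite set \<open>T\<close> from \<open>L\<close> makes \<open>L\<close> safe from all
  remaining \<open>M\<close> at once.
\<close>

lemma (in stage) refine:
  obtains H' L' where "refined_stage Z S D m R c b x H' L'"
proof -
  define f where "f = (\<lambda>M. \<Union>P\<in>Pow {c<..b}. S (insert M (x ` P)))"
  define B where "B = (\<Union>Q\<in>Fpow (x ` {c<..b} \<union> D c). S Q)"
  define T0 where "T0 = (\<Union>P\<in>Pow {c<..b}. S (x ` P))"
  have x_sub: "x ` P \<subseteq> Z" if "P \<subseteq> {c<..b}" for P using that x_in by blast
  have fin: "finite P" if "P \<subseteq> {c<..b}" for P :: "nat set"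
    using that finite_subset by blast
  have f_fin: "finite (f M)" if "M \<in> H" for M
    unfolding f_def using that H_in x_sub fin by (intro finite_UN_I S_finite) auto
  have T0_fin: "finite T0"
    unfolding T0_def using x_sub fin by (intro finite_UN_I S_finite) auto
  have Q_sub: "Q \<subseteq> Z" if "Q \<in> Fpow (x ` {c<..b} \<union> D c)" for Q
    using that x_sub[of "{c<..b}"] D_subset[of c] unfolding Fpow_def by blast
  have "countable (Fpow (x ` {c<..b} \<union> D c))"
    using D_countable by (intro countable_Fpow) simp
  then have "countable B"
    unfolding B_def
  proof (rule countable_UN)
    show "countable (S Q)" if "Q \<in> Fpow (x ` {c<..b} \<union> D c)" for Q
      using S_finite[of Q] Q_sub[OF that] that by (simp add: Fpow_def countable_finite)
  qed
  then have "uncountable (H - B)" using H_uncountable uncountable_minus_countable by blast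
  then obtain H1 where H1: "H1 \<subseteq> H - B" "uncountable H1" "free_for f H1"
    using uncountable_free_subset[of "H - B" f] f_fin by blast
  obtain T where T: "T \<subseteq> L" "finite T" "uncountable {M \<in> H1. f M \<inter> L = T}"
    using uncountable_constant_trace[OF H1(2) L_countable, of f] f_fin H1(1) by blast
  define H' where "H' = {M \<in> H1. f M \<inter> L = T}"
  define L' where "L' = L - T - T0"
  have H'_sub: "H' \<subseteq> H1" unfolding H'_def by blast
  then have H'_H: "H' \<subseteq> H" using H1(1) by blast
  have "infinite (L' \<inter> (D (Suc i) - D i))" if "i < c" for i
  proof -
    have "infinite (L \<inter> (D (Suc i) - D i) - (T \<union> T0))"
      using L_infinite[OF that] T(2) T0_fin by simp
    moreover have "L \<inter> (D (Suc i) - D i) - (T \<union> T0) = L' \<inter> (D (Suc i) - D i)"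
      unfolding L'_def by blast
    ultimately show ?thesis by simp
  qed
  moreover have "uncountable H'" unfolding H'_def by (rule T(3))
  moreover have "countable L'" unfolding L'_def using L_countable by auto
  ultimately have "stage Z S D m R c b x H' L'"
  proof unfold_locales
    show "b \<le> m" by (rule b_le)
    show "x j \<in> Z" if "j \<in> {c<..b}" for j using that by (rule x_in)
    show "H' \<subseteq> Z" using H'_H H_in by blast
    show "x j \<notin> S (x ` A)"
      if "A \<in> order_family m R" "A \<subseteq> {c<..b}" "j \<in> {c<..b}" "j \<notin> A" for A j
      using that by (rule chosen_free)
    show "x j \<notin> S (insert M (x ` P))"
      if "M \<in> H'" "j \<in> {c<..b}" "P \<subseteq> {c<..b}" "\<forall>p\<in>P. (p, j) \<in> R" for M j P
      using that H'_H chosen_free_top by blast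
    show "x j \<notin> S Q" if "j \<in> {c<..b}" "finite Q" "Q \<subseteq> x ` {c<..<j} \<union> D c" for j Q
      using that by (rule chosen_high)
  qed
  moreover have "refined_stage_axioms S D c b x H' L'"
  proof
    show "N \<notin> S (insert M (x ` P))" if "M \<in> H'" "N \<in> H'" "M \<noteq> N" "P \<subseteq> {c<..b}" for M N P
    proof -
      have "N \<notin> f M" using that H'_sub H1(3) unfolding free_for_def by blast
      then show ?thesis using that(4) unfolding f_def by blast
    qed
    show "l \<notin> S (insert M (x ` P))" if "M \<in> H'" "l \<in> L'" "P \<subseteq> {c<..b}" for M l P
    proof -
      have "l \<notin> f M" using that unfolding H'_def L'_def by blast
      then show ?thesis using that(3) unfolding f_def by blast
    qed
    show "l \<notin> S (x ` P)" if "l \<in> L'" "P \<subseteq> {c<..b}" for l P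
      using that unfolding L'_def T0_def by blast
    show "M \<notin> S Q" if "M \<in> H'" "finite Q" "Q \<subseteq> x ` {c<..b} \<union> D c" for M Q
    proof -
      have "M \<notin> B" using that(1) H'_sub H1(1) by blast
      then show ?thesis using that unfolding B_def Fpow_def by blast
    qed
  qed
  ultimately show ?thesis using that unfolding refined_stage_def by blast
qed

lemma order_familyD:
  assumes "A \<in> order_family m R" "k \<in> A" "p \<in> A" "p < k" "j < k" "(j, p) \<in> R" "j \<ge> 1"
  shows "j \<in> A"
proof -
  have "k \<in> {1..m}" "p \<in> {1..m}" using assms(1-3) unfolding order_family_def by blast+
  moreover have "j \<in> {1..m}" using assms(5,7) calculation by auto
  ultimately show ?thesis using assms unfolding order_family_def by blast
qed

text \<open>
  A set in the family that contains the new index has it as maximum. The elements below it form an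
  initial segment of \<open>R\<close>, hence precede every missing index, and \<open>chosen_free_top\<close> applies.
\<close>

lemma (in refined_stage) step_up:
  assumes "Suc b \<le> m" and last: "\<And>i. i \<in> {c<..b} \<Longrightarrow> (i, Suc b) \<in> R" and "c \<le> b"
  obtains x' H' where "stage Z S D m R c (Suc b) x' H' L"
proof -
  obtain v where v: "v \<in> H" using H_uncountable by (metis countable_empty ex_in_conv)
  define y where "y = x(Suc b := v)"
  have y_new: "y (Suc b) = v" unfolding y_def by simp
  have y_old: "y j = x j" if "j \<in> {c<..b}" for j using that unfolding y_def by auto
  have y_img: "y ` P = x ` P" if "P \<subseteq> {c<..b}" for P
    using that y_old by (intro image_cong) auto
  have split: "{c<..Suc b} = insert (Suc b) {c<..b}" using \<open>c \<le> b\<close> by auto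
  have "stage Z S D m R c (Suc b) y (H - {v}) L"
  proof
    show "Suc b \<le> m" by fact
    show "H - {v} \<subseteq> Z" using H_in by blast
    show "uncountable (H - {v})" using H_uncountable uncountable_minus_countable by blast
    show "countable L" by (rule L_countable)
    show "infinite (L \<inter> (D (Suc i) - D i))" if "i < c" for i using L_infinite that .
    show "y j \<in> Z" if "j \<in> {c<..Suc b}" for j
      using that y_old x_in y_new v H_in unfolding split by auto
    show "y j \<notin> S (y ` A)"
      if A: "A \<in> order_family m R" "A \<subseteq> {c<..Suc b}" and j: "j \<in> {c<..Suc b}" "j \<notin> A" for A j
    proof (cases "Suc b \<in> A")
      case False
      then have A': "A \<subseteq> {c<..b}" using A(2) unfolding split by blast
      have "v \<notin> S (x ` A)"
        using A' v finite_subset[OF A'] by (intro H_high) auto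
      then show ?thesis using j chosen_free[OF A(1) A'] y_new y_old y_img[OF A'] unfolding split by auto
    next
      case True
      define P where "P = A - {Suc b}"
      have P: "P \<subseteq> {c<..b}" "A = insert (Suc b) P" using A(2) True unfolding split P_def by auto
      have jb: "j \<in> {c<..b}" using j True unfolding split by auto
      have "(p, j) \<in> R" if p: "p \<in> P" for p
      proof -
        have "(j, p) \<notin> R"
          using order_familyD[OF A(1) True, of p j] p P jb j(2) by auto
        moreover have "p \<noteq> j" using p P(2) j(2) by blast
        moreover have "p \<in> {1..m}" "j \<in> {1..m}" using p P(1) jb b_le by auto
        ultimately show ?thesis using R_total by blast
      qed
      then have "x j \<notin> S (insert v (x ` P))" using chosen_free_top[OF v jb P(1)] by blast
      then show ?thesis using y_old[OF jb] y_img[OF P(1)] y_new P(2) by simp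
    qed
    show "y j \<notin> S (insert M (y ` P))"
      if M: "M \<in> H - {v}" and j: "j \<in> {c<..Suc b}" and P: "P \<subseteq> {c<..Suc b}" "\<forall>p\<in>P. (p, j) \<in> R"
      for M j P
    proof -
      have "Suc b \<notin> P" using P(2) j last R_asym unfolding split by blast
      then have P': "P \<subseteq> {c<..b}" using P(1) unfolding split by blast
      show ?thesis
      proof (cases "j = Suc b")
        case True
        then show ?thesis using H_free[of M v P] M v P' y_new y_img[OF P'] by auto
      next
        case False
        then have "j \<in> {c<..b}" using j unfolding split by blast
        then show ?thesis using chosen_free_top[of M j P] M P(2) P' y_old y_img[OF P'] by auto
      qed
    qed
    show "y j \<notin> S Q" if j: "j \<in> {c<..Suc b}" and Q: "finite Q" "Q \<subseteq> y ` {c<..<j} \<union> D c" for j Q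
    proof -
      have img: "y ` {c<..<j} = x ` {c<..<j}" using j by (intro y_img) auto
      show ?thesis
      proof (cases "j = Suc b")
        case True
        have "{c<..<j} \<subseteq> {c<..b}" using True by auto
        then have "Q \<subseteq> x ` {c<..b} \<union> D c" using Q(2) img by blast
        then show ?thesis using H_high[OF v Q(1)] True y_new by simp
      next
        case False
        then have "j \<in> {c<..b}" using j unfolding split by blast
        then show ?thesis using chosen_high[of j Q] Q img y_old by auto
      qed
    qed
  qed
  then show ?thesis by (rule that)
qed

text \<open>
  Since the new index \<open>c\<close> comes last in \<open>R\<close> so far, a set in the family that contains \<open>c\<close> contains
  all chosen indices below its maximum. A missing index thus lies above the whole set, and
  \<open>chosen_high\<close> applies.
\<close>

lemma (in refined_stage) step_down:
  assumes c: "c = Suc d" and last: "\<And>i. i \<in> {c<..b} \<Longrightarrow> (i, c) \<in> R" and "c \<le> b"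
  obtains x' where "stage Z S D m R d b x' H L"
proof -
  have "infinite (L \<inter> (D c - D d))" using L_infinite[of d] c by simp
  then obtain v where v: "v \<in> L" "v \<in> D c" "v \<notin> D d" by (metis DiffE IntE ex_in_conv finite.emptyI)
  define y where "y = x(c := v)"
  have y_new: "y c = v" unfolding y_def by simp
  have y_old: "y j = x j" if "j \<in> {c<..b}" for j using that unfolding y_def by auto
  have y_img: "y ` P = x ` P" if "P \<subseteq> {c<..b}" for P
    using that y_old by (intro image_cong) auto
  have split: "{d<..b} = insert c {c<..b}" using \<open>c \<le> b\<close> c by auto
  have D_dc: "D d \<subseteq> D c" using D_Suc c by simp
  \<comment> \<open>The new value lies in \<open>D c\<close>, so it is already covered by what \<open>chosen_high\<close> says
      about the old points.\<close>
  have low: "y ` A \<subseteq> x ` {c<..<j} \<union> D c" if "A \<subseteq> {d<..<j}" "j \<in> {c<..b}" for A j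
  proof
    fix z assume "z \<in> y ` A"
    then obtain i where i: "i \<in> A" "z = y i" by blast
    show "z \<in> x ` {c<..<j} \<union> D c"
    proof (cases "i = c")
      case True
      then show ?thesis using i y_new v by simp
    next
      case False
      then have "i \<in> {c<..<j}" using i(1) that(1) c by auto
      moreover from this have "i \<in> {c<..b}" using that(2) by auto
      ultimately show ?thesis using i(2) y_old by auto
    qed
  qed
  have "stage Z S D m R d b y H L"
  proof
    show "b \<le> m" by (rule b_le)
    show "H \<subseteq> Z" by (rule H_in)
    show "uncountable H" by (rule H_uncountable)
    show "countable L" by (rule L_countable)
    show "infinite (L \<inter> (D (Suc i) - D i))" if "i < d" for i using L_infinite that c by simp
    show "y j \<in> Z" if "j \<in> {d<..b}" for j
      using that y_old x_in y_new v D_subset unfolding split by auto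
    show "y j \<notin> S (y ` A)"
      if A: "A \<in> order_family m R" "A \<subseteq> {d<..b}" and j: "j \<in> {d<..b}" "j \<notin> A" for A j
    proof (cases "c \<in> A")
      case False
      then have A': "A \<subseteq> {c<..b}" using A(2) unfolding split by blast
      have "v \<notin> S (x ` A)" using L_free v A' by blast
      then show ?thesis using j chosen_free[OF A(1) A'] y_new y_old y_img[OF A'] unfolding split by auto
    next
      case True
      have jb: "j \<in> {c<..b}" using j True unfolding split by auto
      \<comment> \<open>\<open>j\<close> precedes \<open>c\<close>, so a larger element of \<open>A\<close> would force \<open>j\<close> into \<open>A\<close>.\<close>
      have "A \<subseteq> {d<..<j}"
      proof
        fix k assume k: "k \<in> A"
        have "\<not> j < k"
          using order_familyD[OF A(1) k True, of j] last[OF jb] jb j(2) by auto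
        moreover have "k \<noteq> j" "d < k" using k A(2) j(2) by auto
        ultimately show "k \<in> {d<..<j}" by simp
      qed
      then have "x j \<notin> S (y ` A)"
        using chosen_high[OF jb _ low[OF _ jb]] finite_subset[of A "{d<..<j}"] by blast
      then show ?thesis using y_old[OF jb] by simp
    qed
    show "y j \<notin> S (insert M (y ` P))"
      if M: "M \<in> H" and j: "j \<in> {d<..b}" and P: "P \<subseteq> {d<..b}" "\<forall>p\<in>P. (p, j) \<in> R" for M j P
    proof -
      have "c \<notin> P" using P(2) j last R_asym unfolding split by blast
      then have P': "P \<subseteq> {c<..b}" using P(1) unfolding split by blast
      show ?thesis
      proof (cases "j = c")
        case True
        then show ?thesis using L_free_top[OF M v(1) P'] y_new y_img[OF P'] by simp
      next
        case False
        then have "j \<in> {c<..b}" using j unfolding split by blast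
        then show ?thesis using chosen_free_top[of M j P] M P(2) P' y_old y_img[OF P'] by auto
      qed
    qed
    show "y j \<notin> S Q" if j: "j \<in> {d<..b}" and Q: "finite Q" "Q \<subseteq> y ` {d<..<j} \<union> D d" for j Q
    proof (cases "j = c")
      case True
      then have "{d<..<j} = {}" using c by auto
      then have "Q \<in> Fpow (D d)" using Q unfolding Fpow_def by auto
      then show ?thesis using D_closed v(3) True y_new by blast
    next
      case False
      then have jb: "j \<in> {c<..b}" using j unfolding split by blast
      have "y ` {d<..<j} \<subseteq> x ` {c<..<j} \<union> D c" by (rule low[OF order_refl jb])
      then have "Q \<subseteq> x ` {c<..<j} \<union> D c" using Q(2) D_dc by blast
      then show ?thesis using chosen_high[OF jb Q(1)] y_old[OF jb] by simp
    qed
  qed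
  then show ?thesis by (rule that)
qed

lemma (in tower_order) initial_stage:
  assumes "t \<le> m" "uncountable Z"
  shows "stage Z S D m R t t x Z (D t)"
proof
  have mono: "D i \<subseteq> D j" if "i \<le> j" for i j
    using that by (rule lift_Suc_mono_le[of D, rotated]) (rule D_Suc)
  show "infinite (D t \<inter> (D (Suc i) - D i))" if "i < t" for i
  proof -
    have "D t \<inter> (D (Suc i) - D i) = D (Suc i) - D i" using mono[of "Suc i" t] that by auto
    then show ?thesis using D_gap by simp
  qed
qed (use assms D_countable in auto)

text \<open>
  On an interval around \<open>t\<close> the last element with respect to \<open>R\<close> is one of the two ends. Removing it
  gives the preceding stage.
\<close>

lemma (in tower_order) stage_exists:
  assumes valley: "t \<in> {1..m}"
      "\<And>i. i \<in> {t..<m} \<Longrightarrow> (i, i + 1) \<in> R" "\<And>i. i \<in> {1..<t} \<Longrightarrow> (i + 1, i) \<in> R"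
    and Z: "uncountable Z"
    and "t \<le> b" "b \<le> m" "c < t \<or> (c = t \<and> b = t)"
  shows "\<exists>x H L. stage Z S D m R c b x H L"
  using assms(5-)
proof (induction "b - c" arbitrary: b c rule: less_induct)
  have right: "(i, k) \<in> R" if "t \<le> i" "i < k" "k \<le> m" for i k
  proof -
    have "Suc i \<le> k" using that by simp
    then show ?thesis using \<open>k \<le> m\<close>
    proof (induction k rule: dec_induct)
      case base
      show ?case using valley(2)[of i] that by simp
    next
      case (step n)
      then show ?case using valley(2)[of n] R_trans that by auto
    qed
  qed
  have left: "(k, i) \<in> R" if "1 \<le> i" "i < k" "k \<le> t" for i k
  proof -
    have "Suc i \<le> k" using that by simp
    then show ?thesis using \<open>k \<le> t\<close>
    proof (induction k rule: dec_induct)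
      case base
      show ?case using valley(3)[of i] that by simp
    next
      case (step n)
      then show ?case using valley(3)[of n] R_trans that by auto
    qed
  qed
  case (less b c)
  consider (base) "c = t" "b = t" | (down) "c < t" "b = t \<or> (b, Suc c) \<in> R"
    | (up) "c < t" "t < b" "(b, Suc c) \<notin> R"
    using less.prems by force
  then show ?case
  proof cases
    case base
    then have "stage Z S D m R c b undefined Z (D t)"
      using initial_stage[of t] Z valley(1) by simp
    then show ?thesis by blast
  next
    case down
    have "Suc c < t \<or> (Suc c = t \<and> b = t)"
    proof (cases "Suc c = t")
      case True
      have "\<not> t < b"
      proof
        assume "t < b"
        then have "(t, b) \<in> R" "(b, t) \<in> R" using down(2) True right[of t b] less.prems(2) by auto
        then show False using R_asym by blast
      qed
      then show ?thesis using True less.prems by simp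
    qed (use down in simp)
    moreover have "b - Suc c < b - c" using down less.prems by simp
    ultimately obtain x H L where "stage Z S D m R (Suc c) b x H L"
      using less.hyps[of b "Suc c"] less.prems by blast
    then obtain H' L' where "refined_stage Z S D m R (Suc c) b x H' L'"
      by (rule stage.refine)
    then interpret refined_stage Z S D m R "Suc c" b x H' L' .
    have "(i, Suc c) \<in> R" if i: "i \<in> {Suc c<..b}" for i
    proof (cases "i \<le> t")
      case True
      then show ?thesis using left i by simp
    next
      case False
      then have "(b, Suc c) \<in> R" using down(2) i by auto
      moreover have "i = b \<or> (i, b) \<in> R"
        using right[of i b] False i less.prems(2) by (cases "i = b") auto
      ultimately show ?thesis using R_trans by blast
    qed
    moreover have "Suc c \<le> b" using down less.prems by simp
    ultimately show ?thesis using step_down[OF refl] by blast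
  next
    case up
    then obtain b' where b': "b = Suc b'" using less_imp_Suc_add by blast
    have "b' - c < b - c" "t \<le> b'" "b' \<le> m" using up less.prems b' by auto
    then obtain x H L where "stage Z S D m R c b' x H L"
      using less.hyps[of b' c] up(1) by blast
    then obtain H' L' where "refined_stage Z S D m R c b' x H' L'"
      by (rule stage.refine)
    then interpret refined_stage Z S D m R c b' x H' L' .
    have Rcb: "(Suc c, b) \<in> R" using R_total[of "Suc c" b] up less.prems by auto
    have "(i, Suc b') \<in> R" if i: "i \<in> {c<..b'}" for i
    proof (cases "t \<le> i")
      case True
      then show ?thesis using right i b' less.prems by simp
    next
      case False
      then have "i = Suc c \<or> (i, Suc c) \<in> R"
        using left[of "Suc c" i] i by (cases "i = Suc c") auto
      then show ?thesis using Rcb R_trans b' by blast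
    qed
    moreover have "Suc b' \<le> m" "c \<le> b'" using less.prems up b' by auto
    ultimately show ?thesis using step_up unfolding b' by blast
  qed
qed

section \<open>The bound\<close>

text \<open>
  In the definition of the family only pairs below \<open>m\<close> are ever compared, so \<open>m\<close> itself may be
  added to the order as its last element.
\<close>

lemma order_family_add_top:
  "order_family m (r \<union> {1..m-1} \<times> {m}) = order_family m r"
  unfolding order_family_def by (intro Collect_cong conj_cong refl ball_cong) auto

lemma strict_linear_order_on_add_top:
  fixes m :: nat
  assumes "m \<ge> 1" "r \<subseteq> {1..m-1} \<times> {1..m-1}" "strict_linear_order_on {1..m-1} r"
  shows "strict_linear_order_on {1..m} (r \<union> {1..m-1} \<times> {m})"
proof -
  have m: "m \<notin> {1..m-1}" "{1..m} = insert m {1..m-1}" using assms(1) by auto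
  have r: "trans r" "irrefl r" "total_on {1..m-1} r"
    using assms(3) unfolding strict_linear_order_on_def by auto
  have "trans (r \<union> {1..m-1} \<times> {m})"
  proof (rule transI)
    fix i j k assume ij: "(i, j) \<in> r \<union> {1..m-1} \<times> {m}" and jk: "(j, k) \<in> r \<union> {1..m-1} \<times> {m}"
    have "j \<noteq> m" using jk assms(2) m(1) by blast
    then have "(i, j) \<in> r" using ij by blast
    then show "(i, k) \<in> r \<union> {1..m-1} \<times> {m}"
      using jk transD[OF r(1)] assms(2) by blast
  qed
  moreover have "irrefl (r \<union> {1..m-1} \<times> {m})"
    using r(2) m(1) unfolding irrefl_def by blast
  moreover have "total_on {1..m} (r \<union> {1..m-1} \<times> {m})"
    using r(3) unfolding m(2) total_on_def by blast
  ultimately show ?thesis unfolding strict_linear_order_on_def by blast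
qed

lemma order_family_union: "\<Union>(order_family m r) = {1..m}"
proof -
  have "{i} \<in> order_family m r" if "i \<in> {1..m}" for i
    using that unfolding order_family_def by auto
  then show ?thesis unfolding order_family_def by blast
qed

lemma valley_family_free_realizable:
  fixes Z :: "'u set" and R :: "nat rel"
  assumes Z: "uncountable Z" and R: "strict_linear_order_on {1..m} R"
    and t: "t \<in> {1..m}" "\<And>i. i \<in> {t..<m} \<Longrightarrow> (i, i + 1) \<in> R"
      "\<And>i. i \<in> {1..<t} \<Longrightarrow> (i + 1, i) \<in> R"
  shows "free_realizable Z (order_family m R)"
  unfolding free_realizable_def order_family_union
proof
  fix S0 :: "'u set \<Rightarrow> 'u set" assume S0: "S0 \<in> Fpow Z \<rightarrow> Fpow Z"
  \<comment> \<open>Making the mapping extensive costs nothing and makes distinct indices receive distinct values.\<close>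
  define S where "S = (\<lambda>A. A \<union> S0 A)"
  have S: "S \<in> Fpow Z \<rightarrow> Fpow Z"
  proof
    fix A assume A: "A \<in> Fpow Z"
    then show "S A \<in> Fpow Z"
      using funcset_mem[OF S0 A] unfolding S_def Fpow_def by simp
  qed
  obtain D where "closed_tower Z S D" using closed_tower_exists[OF S Z] .
  then have "tower_order Z S D m R"
    using R unfolding tower_order_def tower_order_axioms_def by blast
  then interpret tower_order Z S D m R .
  obtain x H L where "stage Z S D m R 0 m x H L"
    using stage_exists[OF t Z, of m 0] t(1) by auto
  then interpret stage Z S D m R 0 m x H L .
  have free: "x j \<notin> S (x ` A)" if "A \<in> order_family m R" "j \<in> {1..m}" "j \<notin> A" for A j
  proof -
    have "A \<subseteq> {1..m}" using that(1) unfolding order_family_def by blast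
    then have "A \<subseteq> {0<..m}" "j \<in> {0<..m}" using that(2) by auto
    then show ?thesis using chosen_free that by blast
  qed
  have "inj_on x {1..m}"
  proof (rule inj_onI, rule ccontr)
    fix i j assume ij: "i \<in> {1..m}" "j \<in> {1..m}" "x i = x j" "i \<noteq> j"
    have "{i} \<in> order_family m R" using ij(1) unfolding order_family_def by auto
    then show False using free[of "{i}" j] ij unfolding S_def by auto
  qed
  then have "bij_betw x {1..m} (x ` {1..m})" by (rule inj_on_imp_bij_betw)
  moreover have "x ` {1..m} \<subseteq> Z" using x_in by auto
  moreover have "S0 (x ` A) \<inter> x ` {1..m} \<subseteq> x ` A" if "A \<in> order_family m R" for A
    using free[OF that] unfolding S_def by blast
  ultimately show "\<exists>Y u. Y \<subseteq> Z \<and> bij_betw u {1..m} Y \<and>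
      (\<forall>A\<in>order_family m R. S0 (u ` A) \<inter> Y \<subseteq> u ` A)"
    by blast
qed

lemma has_card_aleph_1_uncountable:
  assumes "has_card_aleph 1 Z"
  shows "uncountable Z"
proof
  assume "countable Z"
  obtain W :: "'a set" where W: "|W| =o natLeq" "|Z| =o cardSuc |W|"
    using assms by auto
  have "|Z| \<le>o natLeq" using \<open>countable Z\<close> by (simp add: countable_card_le_natLeq)
  then have "cardSuc |W| \<le>o |W|"
    using ordIso_ordLeq_trans[OF ordIso_symmetric[OF W(2)]] ordIso_symmetric[OF W(1)]
    by (blast intro: ordLeq_ordIso_trans)
  moreover have "|W| <o cardSuc |W|" using card_of_Card_order by (rule cardSuc_greater)
  ultimately show False using not_ordLess_ordLeq by blast
qed

theorem theorem6p1:
  fixes m :: nat and r :: "nat rel"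
  assumes host: "uncountable (UNIV :: 'u set)"
    and "m \<ge> 2"
    and "r \<subseteq> {1..m-1} \<times> {1..m-1}" and "strict_linear_order_on {1..m-1} r"
    and "\<exists>t\<in>{1..m-1}. (\<forall>i\<in>{t..<m-1}. (i, i + 1) \<in> r) \<and> (\<forall>i\<in>{1..<t}. (i + 1, i) \<in> r)"
  shows "fr TYPE('u) (order_family m r) \<le> 1"
proof -
  obtain Z :: "'u set" where Z: "has_card_aleph 1 Z"
    using uncountable_has_card_aleph_1[OF host] ..
  obtain t where t: "t \<in> {1..m-1}" "\<forall>i\<in>{t..<m-1}. (i, i + 1) \<in> r" "\<forall>i\<in>{1..<t}. (i + 1, i) \<in> r"
    using assms(5) by blast
  let ?R = "r \<union> {1..m-1} \<times> {m}"
  have "(i, i + 1) \<in> ?R" if "i \<in> {t..<m}" for i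
    using that t(1,2) by (cases "i = m - 1") auto
  then have "free_realizable Z (order_family m ?R)"
    using t assms(2-4)
    by (intro valley_family_free_realizable[of Z m ?R t] has_card_aleph_1_uncountable Z
        strict_linear_order_on_add_top) auto
  then have "\<exists>Z :: 'u set. has_card_aleph 1 Z \<and> free_realizable Z (order_family m r)"
    using Z order_family_add_top[of m r] by auto
  then show ?thesis unfolding fr_def by (rule Least_le)
qed

end
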